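(* Let $\mathbb{X}\subseteq\mathbb{R}^n$ be open, let $\bar x\in\mathbb{X}$, let $\omega$ be a size function for $(\mathbb{X},\bar x)$, and let $f:\mathbb{X}\times\mathbb{R}^m\to\mathbb{X}$ be continuous with $f(\bar x,0)=\bar x$. If the discrete-time system $x^+=f(x,u)$ admits an ISS-Lyapunov function $V$, then it is input to state stable (ISS) on $\mathbb{X}$ with respect to $\bar x$.
   Context: Notation: $|\cdot|$ is the Euclidean norm. $\mathcal{K}$ is the set of continuous, strictly increasing $\alpha:[0,\infty)\to[0,\infty)$ with $\alpha(0)=0$; $\mathcal{K}_\infty$ is the set of unbounded elements of $\mathcal{K}$. A function $\beta:[0,\infty)\times[0,\infty)\to[0,\infty)$ is of class $\mathcal{KL}$ if $\beta(\cdot,t)\in\mathcal{K}$ for each fixed $t$, and for each fixed $r$, $\beta(r,t)$ decreases (is nonincreasing in $t$) to $0$ as $t\to\infty$. Size function: $\omega:\mathbb{X}\to\mathbb{R}$ is a size function for $(\mathbb{X},\bar x)$ if it is continuous, positive definite with respect to $\bar x$ ($\omega(\bar x)=0$ and $\omega(x)>0$ for $x\in\mathbb{X}$, $x\ne\bar x$), and proper (for every real $r\ge0$ the sublevel set $\{x\in\mathbb{X}: \omega(x)\le r\}$ is a compact subset of $\mathbb{X}$). Discrete-time ISS: for a bounded input sequence $u=(u_0,u_1,\ldots)$ in $\mathbb{R}^m$, put $\|u\|_\infty=\sup_{t\ge0}|u_t|$; for $x^0\in\mathbb{X}$ let $x(t,x^0,u)$, $t=0,1,2,\ldots$, be the sequence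 defined by $x(0,x^0,u)=x^0$ and $x(t+1,x^0,u)=f(x(t,x^0,u),u_t)$. The system is ISS (on $\mathbb{X}$, with respect to $\bar x$) if there exist $\beta\in\mathcal{KL}$ and $\gamma\in\mathcal{K}_\infty$ such that $\omega(x(t,x^0,u))\le\beta(\omega(x^0),t)+\gamma(\|u\|_\infty)$ for all bounded input sequences $u$, all $x^0\in\mathbb{X}$ and all $t=0,1,2,\ldots$. Discrete-time ISS-Lyapunov function: a continuous $V:\mathbb{X}\to\mathbb{R}$ such that (a) $V-V(\bar x)$ is a size function for $(\mathbb{X},\bar x)$, and (b) there exist a continuous positive definite function $\alpha:[0,\infty)\to[0,\infty)$ (i.e. $\alpha(0)=0$ and $\alpha(r)>0$ for $r>0$) and a function $\chi\in\mathcal{K}_\infty$ such that for all $x\in\mathbb{X}$, $u\in\mathbb{R}^m$: $\omega(x)\ge\chi(|u|)$ implies $V(f(x,u))-V(x)\le-\alpha(V(x)-V(\bar x))$. *)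

theory Defs
  imports "HOL-Analysis.Analysis"
begin

text \<open>Functions on \<open>[0,\<infinity>)\<close> are rendered as total functions on the reals that are constrained only
  on \<^term>\<open>{0..} :: real set\<close>; likewise functions on a state space \<open>X\<close> are constrained only on \<open>X\<close>.
  A function of class \<open>K\<close> maps \<^term>\<open>{0..} :: real set\<close> into itself because it is increasing and
  vanishes at 0.\<close>

definition class_K :: "(real \<Rightarrow> real) \<Rightarrow> bool" where
  "class_K \<alpha> \<longleftrightarrow> continuous_on {0..} \<alpha> \<and> strict_mono_on {0..} \<alpha> \<and> \<alpha> 0 = 0"

definition class_K_inf :: "(real \<Rightarrow> real) \<Rightarrow> bool" where
  "class_K_inf \<alpha> \<longleftrightarrow> class_K \<alpha> \<and> \<not> bounded (\<alpha> ` {0..})"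

definition class_KL :: "(real \<Rightarrow> real \<Rightarrow> real) \<Rightarrow> bool" where
  "class_KL \<beta> \<longleftrightarrow>
     (\<forall>t\<ge>0. class_K (\<lambda>r. \<beta> r t)) \<and>
     (\<forall>r\<ge>0. antimono_on {0..} (\<beta> r) \<and> (\<beta> r \<longlongrightarrow> 0) at_top)"

definition size_function :: "'a::topological_space set \<Rightarrow> 'a \<Rightarrow> ('a \<Rightarrow> real) \<Rightarrow> bool" where
  "size_function X xbar \<omega> \<longleftrightarrow>
     continuous_on X \<omega> \<and>
     \<omega> xbar = 0 \<and> (\<forall>x\<in>X. x \<noteq> xbar \<longrightarrow> 0 < \<omega> x) \<and>
     (\<forall>r\<ge>0. compact {x \<in> X. \<omega> x \<le> r})"

primrec trajectory :: "('a \<Rightarrow> 'b \<Rightarrow> 'a) \<Rightarrow> 'a \<Rightarrow> (nat \<Rightarrow> 'b) \<Rightarrow> nat \<Rightarrow> 'a" where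
  "trajectory f x0 u 0 = x0"
| "trajectory f x0 u (Suc t) = f (trajectory f x0 u t) (u t)"

definition ISS :: "'a set \<Rightarrow> ('a \<Rightarrow> real) \<Rightarrow> ('a \<Rightarrow> 'b::real_normed_vector \<Rightarrow> 'a) \<Rightarrow> bool" where
  "ISS X \<omega> f \<longleftrightarrow>
     (\<exists>\<beta> \<gamma>. class_KL \<beta> \<and> class_K_inf \<gamma> \<and>
       (\<forall>u. bounded (range u) \<longrightarrow>
         (\<forall>x0\<in>X. \<forall>t.
           \<omega> (trajectory f x0 u t) \<le> \<beta> (\<omega> x0) (real t) + \<gamma> (SUP s. norm (u s)))))"

definition ISS_Lyapunov ::
  "'a::topological_space set \<Rightarrow> 'a \<Rightarrow> ('a \<Rightarrow> real) \<Rightarrow> ('a \<Rightarrow> 'b::real_normed_vector \<Rightarrow> 'a) \<Rightarrow>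
     ('a \<Rightarrow> real) \<Rightarrow> bool" where
  "ISS_Lyapunov X xbar \<omega> f V \<longleftrightarrow>
     continuous_on X V \<and>
     size_function X xbar (\<lambda>x. V x - V xbar) \<and>
     (\<exists>\<alpha> chi. continuous_on {0..} \<alpha> \<and> \<alpha> 0 = 0 \<and> (\<forall>r>0. 0 < \<alpha> r) \<and>
        class_K_inf chi \<and>
        (\<forall>x\<in>X. \<forall>u. \<omega> x \<ge> chi (norm u) \<longrightarrow> V (f x u) - V x \<le> - \<alpha> (V x - V xbar)))"

end

theory Submission
  imports Defs
begin

text \<open>Write \<open>W x = V x - V xbar\<close> and let \<open>c\<close> bound the inputs. By compactness of sublevel sets,
  \<open>\<omega>\<close> is bounded by a class K function \<open>\<kappa>\<close> of \<open>W\<close>, \<open>W\<close> by a class K function \<open>\<mu>\<close> of \<open>\<omega>\<close>,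
  and \<open>W x\<close> and \<open>W (f x u)\<close> by a class K function \<open>b c\<close> whenever \<open>\<omega> x \<le> chi c\<close> and \<open>|u| \<le> c\<close>.
  So the sublevel set \<open>{W \<le> b c}\<close> is forward invariant, and outside it the dissipation inequality
  holds. With \<open>g s\<close> the maximum of \<open>\<tau> - \<alpha> \<tau>\<close> over \<open>[0, s]\<close>, a continuous monotone
  function below the identity, \<open>W\<close> along a trajectory is therefore at most
  the maximum of \<open>g\<^sup>t (\<mu> (\<omega> x0))\<close> and \<open>b c\<close>, and the iterates of \<open>g\<close> tend to 0.\<close>

section \<open>Calculus of class K functions\<close>

lemma class_K_nonneg:
  assumes "class_K \<alpha>" "0 \<le> s"
  shows "0 \<le> \<alpha> s"
  using assms strict_mono_onD[of "{0..}" \<alpha> 0 s] unfolding class_K_def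
  by (cases "s = 0") auto

lemma class_K_mono:
  assumes "class_K \<alpha>" "0 \<le> s" "s \<le> t"
  shows "\<alpha> s \<le> \<alpha> t"
  using assms strict_mono_onD[of "{0..}" \<alpha> s t] unfolding class_K_def
  by (cases "s = t") auto

lemma class_K_add:
  assumes "class_K \<alpha>" "class_K \<beta>"
  shows "class_K (\<lambda>s. \<alpha> s + \<beta> s)"
  using assms unfolding class_K_def strict_mono_on_def
  by (auto intro!: continuous_intros add_strict_mono)

lemma class_K_compose:
  assumes "class_K \<alpha>" "class_K \<beta>"
  shows "class_K (\<lambda>s. \<alpha> (\<beta> s))"
proof -
  have "continuous_on {0..} (\<lambda>s. \<alpha> (\<beta> s))"
    by (rule continuous_on_compose2[of "{0..}" \<alpha> _ \<beta>])
       (use assms class_K_nonneg[OF assms(2)] in \<open>auto simp: class_K_def\<close>)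
  moreover have "strict_mono_on {0..} (\<lambda>s. \<alpha> (\<beta> s))"
    using assms class_K_nonneg[OF assms(2)]
    by (auto simp: class_K_def strict_mono_on_def)
  ultimately show ?thesis
    using assms by (auto simp: class_K_def)
qed

text \<open>Supplies the strictness that monotone constructions lack: running maxima and iterates of
  a gain may be flat on intervals, and one class K summand repairs this.\<close>

lemma class_K_add_strict:
  assumes "continuous_on {0..} \<phi>" "mono_on {0..} \<phi>" "\<phi> 0 = 0" "class_K \<alpha>"
  shows "class_K (\<lambda>s. \<phi> s + \<alpha> s)"
  using assms unfolding class_K_def strict_mono_on_def
  by (auto intro!: continuous_intros add_le_less_mono mono_onD[of "{0..}" \<phi>])

lemma class_K_mult_right: "0 < c \<Longrightarrow> class_K (\<lambda>s. s * c)"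
  by (auto simp: class_K_def strict_mono_on_def intro!: continuous_intros)

lemma class_K_id: "class_K (\<lambda>s. s)"
  using class_K_mult_right[of 1] by simp

text \<open>Used for the final gain, whose composite part may be bounded; the identity summand
  forces growth past every bound.\<close>

lemma class_K_inf_add_id:
  assumes "class_K \<alpha>"
  shows "class_K_inf (\<lambda>s. \<alpha> s + s)"
  unfolding class_K_inf_def
proof
  show "class_K (\<lambda>s. \<alpha> s + s)"
    by (intro class_K_add class_K_id assms)
  show "\<not> bounded ((\<lambda>s. \<alpha> s + s) ` {0..})"
  proof
    assume "bounded ((\<lambda>s. \<alpha> s + s) ` {0..})"
    then obtain B where B: "\<And>s. 0 \<le> s \<Longrightarrow> \<bar>\<alpha> s + s\<bar> \<le> B"
      by (auto simp: bounded_iff)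
    from B[of 0] have "0 \<le> B" by simp
    with B[of "B + 1"] class_K_nonneg[OF assms, of "B + 1"] show False
      by simp
  qed
qed

section \<open>Running maxima as monotone envelopes of continuous functions\<close>

definition running_max :: "(real \<Rightarrow> real) \<Rightarrow> real \<Rightarrow> real" where
  "running_max h s = Sup (h ` {0..s})"

context
  fixes h :: "real \<Rightarrow> real"
  assumes cont: "continuous_on {0..} h"
begin

lemma running_max_attained:
  assumes "0 \<le> s"
  obtains \<tau> where "0 \<le> \<tau>" "\<tau> \<le> s" "running_max h s = h \<tau>"
    "\<And>\<sigma>. 0 \<le> \<sigma> \<Longrightarrow> \<sigma> \<le> s \<Longrightarrow> h \<sigma> \<le> running_max h s"
proof -
  have "continuous_on {0..s} h"
    using cont by (rule continuous_on_subset) auto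
  then obtain \<tau> where \<tau>: "\<tau> \<in> {0..s}" "\<forall>\<sigma>\<in>{0..s}. h \<sigma> \<le> h \<tau>"
    using continuous_attains_sup[of "{0..s}" h] assms by auto
  then have "running_max h s = h \<tau>"
    unfolding running_max_def by (intro cSup_eq_maximum) auto
  with \<tau> show thesis by (intro that[of \<tau>]) auto
qed

lemma running_max_upper: "0 \<le> \<sigma> \<Longrightarrow> \<sigma> \<le> s \<Longrightarrow> h \<sigma> \<le> running_max h s"
  by (rule running_max_attained[of s]) auto

lemma running_max_mono: "mono_on {0..} (running_max h)"
proof (rule mono_onI)
  fix s t :: real
  assume st: "s \<in> {0..}" "t \<in> {0..}" "s \<le> t"
  then obtain \<tau> where "0 \<le> \<tau>" "\<tau> \<le> s" "running_max h s = h \<tau>"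
    using running_max_attained[of s] by (metis atLeast_iff)
  then show "running_max h s \<le> running_max h t"
    using running_max_upper[of \<tau> t] st by simp
qed

text \<open>Extending the interval from \<open>[0, a]\<close> to \<open>[0, b]\<close> raises the
  maximum only if it is attained in \<open>(a, b]\<close>, so the increase is controlled by the
  oscillation of \<open>h\<close> there.\<close>

lemma continuous_on_running_max: "continuous_on {0..} (running_max h)"
  unfolding continuous_on_iff
proof (intro ballI allI impI)
  fix s e :: real
  assume s: "s \<in> {0..}" and e: "0 < e"
  with cont obtain d where d: "0 < d"
    and hd: "\<And>\<tau>. 0 \<le> \<tau> \<Longrightarrow> \<bar>\<tau> - s\<bar> < d \<Longrightarrow> \<bar>h \<tau> - h s\<bar> < e / 3"
    unfolding continuous_on_iff dist_real_def
    by (metis atLeast_iff zero_less_divide_iff zero_less_numeral)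
  \<comment> \<open>If the maximiser lies in \<open>[0, a]\<close>, nothing is gained. Otherwise its
    value and \<open>h a\<close> both differ from \<open>h s\<close> by less than
    \<open>e / 3\<close>, and the total \<open>2 * (e / 3)\<close> stays strictly below
    \<open>e\<close>.\<close>
  have step: "running_max h b \<le> running_max h a + 2 * (e / 3)"
    if ab: "0 \<le> a" "a \<le> b" "\<bar>a - s\<bar> < d" "\<bar>b - s\<bar> < d" for a b
  proof -
    obtain \<tau> where \<tau>: "0 \<le> \<tau>" "\<tau> \<le> b" "running_max h b = h \<tau>"
      using running_max_attained[of b] ab by (metis order.trans)
    show ?thesis
    proof (cases "\<tau> \<le> a")
      case True
      then show ?thesis using running_max_upper[of \<tau> a] \<tau> e by simp
    next
      case False
      then have "\<bar>\<tau> - s\<bar> < d" using \<tau> ab by auto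
      then have "\<bar>h \<tau> - h s\<bar> < e / 3" "\<bar>h a - h s\<bar> < e / 3"
        using hd \<tau> ab by auto
      then show ?thesis using running_max_upper[of a a] ab \<tau> by arith
    qed
  qed
  show "\<exists>d>0. \<forall>x'\<in>{0..}. dist x' s < d \<longrightarrow> dist (running_max h x') (running_max h s) < e"
  proof (intro exI[of _ d] conjI ballI impI d)
    fix t :: real
    assume t: "t \<in> {0..}" "dist t s < d"
    show "dist (running_max h t) (running_max h s) < e"
    proof (cases "t \<le> s")
      case True
      then have "running_max h t \<le> running_max h s"
        using mono_onD[OF running_max_mono t(1) s] by simp
      with step[of t s] True s t d e show ?thesis by (auto simp: dist_real_def)
    next
      case False
      then have "running_max h s \<le> running_max h t"
        using mono_onD[OF running_max_mono s t(1)] by simp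
      with step[of s t] False s t d e show ?thesis by (auto simp: dist_real_def)
    qed
  qed
qed

end

section \<open>Class K bounds relative to a size function\<close>

text \<open>The mean of \<open>\<phi>\<close> over \<open>[s, 2s]\<close> is continuous in \<open>s\<close> and lies between \<open>\<phi> s\<close> and \<open>\<phi> (2s)\<close>.\<close>

lemma continuous_majorant:
  fixes \<phi> :: "real \<Rightarrow> real"
  assumes mono: "mono_on {0..} \<phi>" and zero: "\<phi> 0 = 0" and lim: "(\<phi> \<longlongrightarrow> 0) (at_right 0)"
  obtains \<psi> where "continuous_on {0..} \<psi>" "\<psi> 0 = 0" "\<And>s. 0 \<le> s \<Longrightarrow> \<phi> s \<le> \<psi> s"
proof -
  define F where "F s = integral {0..s} \<phi>" for s
  \<comment> \<open>At \<open>s = 0\<close> division by zero returns 0, exactly the value wanted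
    there.\<close>
  define \<psi> where "\<psi> s = (F (2 * s) - F s) / s" for s
  have int: "\<phi> integrable_on {a..b}" if "0 \<le> a" for a b
    using mono that by (intro integrable_on_mono_on mono_on_subset[OF mono]) auto
  have F_diff: "F (2 * s) - F s = integral {s..2 * s} \<phi>" if "0 < s" for s
    unfolding F_def using that int[of 0 "2 * s"]
      Henstock_Kurzweil_Integration.integral_combine[of 0 s "2 * s" \<phi>] by simp
  have lower: "\<phi> s \<le> \<psi> s" if "0 < s" for s
  proof -
    have "integral {s..2 * s} (\<lambda>_. \<phi> s) \<le> integral {s..2 * s} \<phi>"
      using that by (intro integral_le int mono_onD[OF mono]) auto
    then show ?thesis using that F_diff[OF that] by (simp add: \<psi>_def field_simps)
  qed
  have upper: "\<psi> s \<le> \<phi> (2 * s)" if "0 < s" for s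
  proof -
    have "integral {s..2 * s} \<phi> \<le> integral {s..2 * s} (\<lambda>_. \<phi> (2 * s))"
      using that by (intro integral_le int mono_onD[OF mono]) auto
    then show ?thesis using that F_diff[OF that] by (simp add: \<psi>_def field_simps)
  qed
  \<comment> \<open>An indefinite integral is continuous even where \<open>\<phi>\<close> jumps, so
    \<open>\<psi>\<close> is continuous away from 0; the point 0 is left to a squeeze
    argument.\<close>
  have contF: "isCont F s" if "0 < s" for s
  proof -
    have "continuous_on {0..s + 1} F"
      unfolding F_def by (intro indefinite_integral_continuous_1 int) simp
    then show ?thesis
      using that by (intro continuous_on_interior[of "{0..s+1}"]) auto
  qed
  have "continuous_on {0..} \<psi>"
    unfolding continuous_on_eq_continuous_within
  proof
    fix s :: real
    assume "s \<in> {0..}"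
    show "continuous (at s within {0..}) \<psi>"
    proof (cases "s = 0")
      case False
      with \<open>s \<in> {0..}\<close> have "0 < s" by simp
      have "isCont (\<lambda>s. F (2 * s)) s"
        using \<open>0 < s\<close> by (auto intro!: isCont_o2[of _ "\<lambda>s. 2 * s" F] contF)
      then have "isCont \<psi> s"
        unfolding \<psi>_def using \<open>0 < s\<close> contF[of s] by (intro isCont_divide isCont_diff continuous_ident) simp_all
      then show ?thesis by (rule continuous_at_imp_continuous_at_within)
    next
      case True
      have "filterlim (\<lambda>s::real. 2 * s) (at_right 0) (at_right 0)"
        unfolding filterlim_at
        by (auto intro!: tendsto_eq_intros eventually_mono[OF eventually_at_right_less])
      then have lim2: "((\<lambda>s. \<phi> (2 * s)) \<longlongrightarrow> 0) (at_right 0)"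
        by (rule filterlim_compose[OF lim])
      have "(\<psi> \<longlongrightarrow> 0) (at_right 0)"
        by (rule tendsto_sandwich[OF _ _ lim lim2])
           (auto simp: eventually_at_right_less lower upper intro: eventually_mono[OF eventually_at_right_less])
      then show ?thesis
        using True by (simp add: continuous_within at_within_Ici_at_right \<psi>_def)
    qed
  qed
  moreover have "\<psi> 0 = 0" by (simp add: \<psi>_def)
  moreover have "\<phi> s \<le> \<psi> s" if "0 \<le> s" for s
    using that lower[of s] zero calculation(2) by (cases "s = 0") auto
  ultimately show thesis by (rule that)
qed

lemma size_function_nonneg:
  assumes "size_function X xbar b" "x \<in> X"
  shows "0 \<le> b x"
  using assms unfolding size_function_def by (cases "x = xbar") (auto intro: less_imp_le)

text \<open>On the compact sublevel sets of \<open>b\<close> the function \<open>a\<close> is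
  bounded above. Its supremum is monotone in the level, and it tends to 0 at level 0 because these
  sets shrink to \<open>xbar\<close>. A continuous majorant of this supremum is then upgraded to
  class K.\<close>

lemma size_function_dominates:
  fixes X :: "'a::t2_space set" and a b :: "'a \<Rightarrow> real"
  assumes size: "size_function X xbar b" and "xbar \<in> X"
    and cont: "continuous_on X a" and "a xbar = 0"
  obtains \<kappa> where "class_K \<kappa>" "\<And>x. x \<in> X \<Longrightarrow> a x \<le> \<kappa> (b x)"
proof -
  have b0: "b xbar = 0" and contb: "continuous_on X b"
    and posb: "\<And>x. x \<in> X \<Longrightarrow> x \<noteq> xbar \<Longrightarrow> 0 < b x"
    using size by (auto simp: size_function_def)
  define K where "K s = {x \<in> X. b x \<le> s}" for s
  have compact: "compact (K s)" if "0 \<le> s" for s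
    using size that by (auto simp: size_function_def K_def)
  have K_sub: "K s \<subseteq> X" and K_mono: "s \<le> t \<Longrightarrow> K s \<subseteq> K t" for s t
    by (auto simp: K_def)
  have xK: "xbar \<in> K s" if "0 \<le> s" for s
    using that b0 \<open>xbar \<in> X\<close> by (simp add: K_def)
  have bdd: "bdd_above (a ` K s)" if "0 \<le> s" for s
    using compact_continuous_image[OF continuous_on_subset[OF cont K_sub] compact[OF that]]
    by (intro bounded_imp_bdd_above compact_imp_bounded)
  define \<phi> where "\<phi> s = (SUP x\<in>K s. a x)" for s
  have \<phi>_upper: "a x \<le> \<phi> s" if "x \<in> X" "b x \<le> s" "0 \<le> s" for x s
    unfolding \<phi>_def using that bdd by (intro cSUP_upper) (auto simp: K_def)
  have \<phi>_nonneg: "0 \<le> \<phi> s" if "0 \<le> s" for s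
    using \<phi>_upper[of xbar s] that \<open>xbar \<in> X\<close> b0 \<open>a xbar = 0\<close> by simp
  have mono: "mono_on {0..} \<phi>"
    unfolding \<phi>_def using xK bdd K_mono by (intro mono_onI cSUP_subset_mono) force+
  have "K 0 = {xbar}"
    using b0 posb \<open>xbar \<in> X\<close> by (force simp: K_def)
  then have zero: "\<phi> 0 = 0" by (simp add: \<phi>_def \<open>a xbar = 0\<close>)
  \<comment> \<open>The points of \<open>K 1\<close> with \<open>a x \<ge> e\<close> form a compact
    set \<open>C\<close> that misses \<open>xbar\<close>. If \<open>C\<close> is nonempty,
    \<open>b\<close> has a positive minimum on it, and a level below this minimum excludes
    \<open>C\<close>.\<close>
  have small: "\<exists>d>0. \<phi> d \<le> e" if e: "0 < e" for e
  proof -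
    define C where "C = K 1 \<inter> a -` {e..}"
    have "closedin (top_of_set (K 1)) C"
      unfolding C_def
      by (intro continuous_closedin_preimage continuous_on_subset[OF cont K_sub]) auto
    then have "compact C"
      using closedin_compact compact[of 1] by auto
    show ?thesis
    proof (cases "C = {}")
      case True
      then have "\<phi> 1 \<le> e"
        unfolding \<phi>_def using xK[of 1] by (intro cSUP_least) (auto simp: C_def)
      then show ?thesis by (intro exI[of _ 1]) simp
    next
      case False
      have "continuous_on C b"
        using contb by (rule continuous_on_subset) (auto simp: C_def K_def)
      then obtain y where y: "y \<in> C" "\<And>x. x \<in> C \<Longrightarrow> b y \<le> b x"
        using continuous_attains_inf[OF \<open>compact C\<close> False] by blast
      have "y \<noteq> xbar" using y(1) e \<open>a xbar = 0\<close> by (auto simp: C_def)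
      then have "0 < b y" using y(1) posb by (auto simp: C_def K_def)
      define d where "d = min 1 (b y / 2)"
      have d: "0 < d" "d \<le> 1" "d < b y" using \<open>0 < b y\<close> by (auto simp: d_def)
      have "a x \<le> e" if "x \<in> K d" for x
      proof (rule ccontr)
        assume "\<not> a x \<le> e"
        then have "x \<in> C" using that d by (auto simp: C_def K_def)
        then show False using y(2)[of x] that d by (auto simp: K_def)
      qed
      then have "\<phi> d \<le> e"
        unfolding \<phi>_def using xK[of d] d by (intro cSUP_least) auto
      with d show ?thesis by auto
    qed
  qed
  have lim: "(\<phi> \<longlongrightarrow> 0) (at_right 0)"
  proof (rule tendstoI)
    fix e :: real
    assume "0 < e"
    \<comment> \<open>By monotonicity the bound at the single point \<open>d\<close> covers all
      smaller arguments; halving \<open>e\<close> makes the inequality strict.\<close>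
    then obtain d where d: "0 < d" "\<phi> d \<le> e / 2" using small[of "e / 2"] by auto
    have "dist (\<phi> s) 0 < e" if "0 < s" "s < d" for s
      using that d \<open>0 < e\<close> \<phi>_nonneg[of s] mono_onD[OF mono, of s d] by (simp add: dist_real_def)
    then show "\<forall>\<^sub>F s in at_right 0. dist (\<phi> s) 0 < e"
      using d by (auto simp: eventually_at_right_field)
  qed
  obtain \<psi> where \<psi>: "continuous_on {0..} \<psi>" "\<psi> 0 = 0" "\<And>s. 0 \<le> s \<Longrightarrow> \<phi> s \<le> \<psi> s"
    using continuous_majorant[OF mono zero lim] by blast
  \<comment> \<open>The running maximum supplies monotonicity while staying above
    \<open>\<psi>\<close>; the summand \<open>s\<close> supplies strictness.\<close>
  have "class_K (\<lambda>s. running_max \<psi> s + s)"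
    by (intro class_K_add_strict continuous_on_running_max running_max_mono class_K_id \<psi>)
       (simp add: running_max_def \<psi>)
  moreover have "a x \<le> running_max \<psi> (b x) + b x" if "x \<in> X" for x
  proof -
    have "0 \<le> b x" using size that by (rule size_function_nonneg)
    then show ?thesis
      using \<phi>_upper[of x "b x"] \<psi>(3)[of "b x"] running_max_upper[OF \<psi>(1), of "b x" "b x"] that
      by simp
  qed
  ultimately show thesis by (rule that)
qed

section \<open>Iterates of a monotone gain below the identity\<close>

locale contractive_gain =
  fixes g :: "real \<Rightarrow> real"
  assumes cont: "continuous_on {0..} g" and mono: "mono_on {0..} g"
    and zero: "g 0 = 0" and less: "\<And>s. 0 < s \<Longrightarrow> g s < s"
begin

lemma nonneg: "0 \<le> s \<Longrightarrow> 0 \<le> g s"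
  using mono_onD[OF mono, of 0 s] zero by simp

lemma le: "0 \<le> s \<Longrightarrow> g s \<le> s"
  using less[of s] zero by (cases "s = 0") auto

lemma funpow_nonneg: "0 \<le> s \<Longrightarrow> 0 \<le> (g ^^ n) s"
  by (induction n) (auto intro: nonneg)

lemma funpow_zero: "(g ^^ n) 0 = 0"
  by (induction n) (auto simp: zero)

lemma funpow_mono: "mono_on {0..} (g ^^ n)"
proof (induction n)
  case (Suc n)
  show ?case
    using funpow_nonneg
    by (auto intro!: mono_onI mono_onD[OF mono] mono_onD[OF Suc])
qed (auto intro: mono_onI)

lemma continuous_on_funpow: "continuous_on {0..} (g ^^ n)"
proof (induction n)
  case (Suc n)
  then show ?case
    using continuous_on_compose2[OF cont Suc] funpow_nonneg by (auto simp: comp_def)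
qed (auto simp: id_def)

lemma funpow_antimono: "0 \<le> s \<Longrightarrow> antimono (\<lambda>n. (g ^^ n) s)"
  by (intro decseq_SucI) (auto intro: le funpow_nonneg)

text \<open>The iterates decrease and are bounded below by 0, hence converge. By continuity the
  limit is a fixed point of \<open>g\<close>, and \<open>g s < s\<close> for positive
  \<open>s\<close> leaves only 0.\<close>

lemma funpow_tendsto_0:
  assumes "0 \<le> s"
  shows "(\<lambda>n. (g ^^ n) s) \<longlonglongrightarrow> 0"
proof -
  obtain L where L: "(\<lambda>n. (g ^^ n) s) \<longlonglongrightarrow> L"
    using decseq_convergent[OF funpow_antimono[OF assms]] funpow_nonneg[OF assms] by metis
  have "0 \<le> L"
    using funpow_nonneg[OF assms] by (intro LIMSEQ_le_const[OF L]) auto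
  have "(\<lambda>n. g ((g ^^ n) s)) \<longlonglongrightarrow> g L"
    using \<open>0 \<le> L\<close> funpow_nonneg[OF assms]
    by (intro continuous_on_tendsto_compose[OF cont L]) auto
  then have "g L = L"
    using LIMSEQ_Suc[OF L] by (intro LIMSEQ_unique) simp_all
  with less[of L] \<open>0 \<le> L\<close> L show ?thesis by (cases "L = 0") auto
qed

text \<open>Class KL does not require continuity in time, so iterates at the integer part of \<open>t\<close> suffice;
  the last summand makes the function strictly increasing in \<open>r\<close>.\<close>

lemma class_KL_funpow:
  assumes \<kappa>: "class_K \<kappa>" and \<mu>: "class_K \<mu>"
  shows "class_KL (\<lambda>r t. \<kappa> ((g ^^ nat \<lfloor>t\<rfloor>) (\<mu> r)) + r * (1 / (1 + t)))"
  unfolding class_KL_def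
proof (intro conjI allI impI)
  note nonneg_\<mu> = class_K_nonneg[OF \<mu>]
  fix t :: real
  assume t: "0 \<le> t"
  have cont_g\<mu>: "continuous_on {0..} (\<lambda>r. (g ^^ n) (\<mu> r))" for n
    by (rule continuous_on_compose2[OF continuous_on_funpow])
       (use \<mu> nonneg_\<mu> in \<open>auto simp: class_K_def\<close>)
  have cont_\<kappa>: "continuous_on {0..} \<kappa>"
    using \<kappa> by (simp add: class_K_def)
  have "continuous_on {0..} (\<lambda>r. \<kappa> ((g ^^ n) (\<mu> r)))" for n
    by (rule continuous_on_compose2[OF cont_\<kappa> cont_g\<mu>])
       (simp add: image_subset_iff nonneg_\<mu> funpow_nonneg)
  moreover have "mono_on {0..} (\<lambda>r. \<kappa> ((g ^^ n) (\<mu> r)))" for n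
    using nonneg_\<mu>
    by (intro mono_onI class_K_mono[OF \<kappa>] mono_onD[OF funpow_mono])
       (auto intro: funpow_nonneg class_K_mono[OF \<mu>])
  ultimately show "class_K (\<lambda>r. \<kappa> ((g ^^ nat \<lfloor>t\<rfloor>) (\<mu> r)) + r * (1 / (1 + t)))"
    using t \<kappa> \<mu> by (intro class_K_add_strict class_K_mult_right) (auto simp: class_K_def funpow_zero)
next
  fix r :: real
  assume r: "0 \<le> r"
  then have \<mu>r: "0 \<le> \<mu> r" by (rule class_K_nonneg[OF \<mu>])
  show "antimono_on {0..} (\<lambda>t. \<kappa> ((g ^^ nat \<lfloor>t\<rfloor>) (\<mu> r)) + r * (1 / (1 + t)))"
  proof (rule monotone_onI, rule add_mono)
    fix s t :: real
    assume st: "s \<in> {0..}" "t \<in> {0..}" "s \<le> t"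
    then have "(g ^^ nat \<lfloor>t\<rfloor>) (\<mu> r) \<le> (g ^^ nat \<lfloor>s\<rfloor>) (\<mu> r)"
      by (intro antimonoD[OF funpow_antimono[OF \<mu>r]] nat_mono floor_mono)
    then show "\<kappa> ((g ^^ nat \<lfloor>t\<rfloor>) (\<mu> r)) \<le> \<kappa> ((g ^^ nat \<lfloor>s\<rfloor>) (\<mu> r))"
      by (intro class_K_mono[OF \<kappa>] funpow_nonneg \<mu>r)
    show "r * (1 / (1 + t)) \<le> r * (1 / (1 + s))"
      using st r by (intro mult_left_mono divide_left_mono) auto
  qed
  have "filterlim (\<lambda>t::real. nat \<lfloor>t\<rfloor>) sequentially at_top"
    by (rule filterlim_compose[OF filterlim_nat_sequentially filterlim_floor_sequentially])
  then have "((\<lambda>t::real. (g ^^ nat \<lfloor>t\<rfloor>) (\<mu> r)) \<longlongrightarrow> 0) at_top"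
    by (rule filterlim_compose[OF funpow_tendsto_0[OF \<mu>r]])
  then have "((\<lambda>t::real. \<kappa> ((g ^^ nat \<lfloor>t\<rfloor>) (\<mu> r))) \<longlongrightarrow> \<kappa> 0) at_top"
    using \<kappa> \<mu>r by (intro continuous_on_tendsto_compose[of "{0..}" \<kappa>])
      (auto simp: class_K_def funpow_nonneg)
  moreover have "((\<lambda>t::real. r * (1 / (1 + t))) \<longlongrightarrow> 0) at_top"
    by (intro tendsto_mult_right_zero tendsto_divide_0[OF tendsto_const]
        filterlim_at_top_imp_at_infinity filterlim_tendsto_add_at_top[OF tendsto_const] filterlim_ident)
  ultimately show "((\<lambda>t. \<kappa> ((g ^^ nat \<lfloor>t\<rfloor>) (\<mu> r)) + r * (1 / (1 + t))) \<longlongrightarrow> 0) at_top"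
    using \<kappa> by (auto simp: class_K_def intro: tendsto_add_zero)
qed

end

text \<open>The function \<open>s - \<alpha> s\<close> may be neither monotone nor nonnegative. Its
  running maximum is monotone and starts at 0. It stays below \<open>s\<close> because it is
  attained at some \<open>\<tau> \<le> s\<close>: either \<open>\<tau> = 0\<close> with value 0, or
  \<open>\<alpha> \<tau> > 0\<close>.\<close>

lemma contractive_gain_running_max:
  assumes "continuous_on {0..} \<alpha>" "\<alpha> 0 = 0" "\<And>r. 0 < r \<Longrightarrow> 0 < \<alpha> r"
  shows "contractive_gain (running_max (\<lambda>s. s - \<alpha> s))"
proof
  have cont: "continuous_on {0..} (\<lambda>s. s - \<alpha> s)"
    using assms by (intro continuous_intros)
  show "continuous_on {0..} (running_max (\<lambda>s. s - \<alpha> s))"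
    using cont by (rule continuous_on_running_max)
  show "mono_on {0..} (running_max (\<lambda>s. s - \<alpha> s))"
    using cont by (rule running_max_mono)
  show "running_max (\<lambda>s. s - \<alpha> s) 0 = 0"
    by (simp add: running_max_def assms)
  fix s :: real
  assume "0 < s"
  obtain \<tau> where "0 \<le> \<tau>" "\<tau> \<le> s" "running_max (\<lambda>s. s - \<alpha> s) s = \<tau> - \<alpha> \<tau>"
    by (rule running_max_attained[OF cont, of s]) (use \<open>0 < s\<close> in auto)
  with \<open>0 < s\<close> assms(2) assms(3)[of \<tau>] show "running_max (\<lambda>s. s - \<alpha> s) s < s"
    by (cases "\<tau> = 0") auto
qed

text \<open>Allows the domination lemma to act on state-input pairs, bounding \<open>W\<close> after
  one step. Sublevel sets are products of a sublevel set of \<open>\<omega>\<close> with a closed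
  ball, hence compact.\<close>

lemma size_function_prod_norm:
  fixes \<omega> :: "'a::t2_space \<Rightarrow> real"
  assumes "size_function X xbar \<omega>"
  shows "size_function (X \<times> (UNIV :: 'b::euclidean_space set)) (xbar, 0) (\<lambda>(x, u). max (\<omega> x) (norm u))"
  unfolding size_function_def
proof (intro conjI allI impI ballI)
  have "continuous_on X \<omega>" using assms by (simp add: size_function_def)
  then have "continuous_on (X \<times> (UNIV :: 'b set)) (\<lambda>z. \<omega> (fst z))"
    by (rule continuous_on_compose2) (auto intro: continuous_intros)
  then show "continuous_on (X \<times> (UNIV :: 'b set)) (\<lambda>(x, u). max (\<omega> x) (norm u))"
    unfolding case_prod_unfold by (intro continuous_on_max continuous_intros)
next
  fix r :: real
  assume "0 \<le> r"
  then have "compact ({x \<in> X. \<omega> x \<le> r} \<times> cball (0::'b) r)"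
    using assms by (intro compact_Times) (auto simp: size_function_def)
  also have "{x \<in> X. \<omega> x \<le> r} \<times> cball (0::'b) r =
      {z \<in> X \<times> UNIV. (case z of (x, u) \<Rightarrow> max (\<omega> x) (norm u)) \<le> r}"
    by auto
  finally show "compact {z \<in> X \<times> (UNIV :: 'b set). (case z of (x, u) \<Rightarrow> max (\<omega> x) (norm u)) \<le> r}" .
qed (use assms in \<open>auto simp: size_function_def less_max_iff_disj\<close>)

section \<open>Comparison estimate along trajectories\<close>

theorem theorem3:
  fixes X :: "(real ^ 'n) set" and xbar :: "real ^ 'n"
    and \<omega> V :: "real ^ 'n \<Rightarrow> real"
    and f :: "real ^ 'n \<Rightarrow> real ^ 'm \<Rightarrow> real ^ 'n"
  assumes "open X" and "xbar \<in> X"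
    and "size_function X xbar \<omega>"
    and "continuous_on (X \<times> UNIV) (\<lambda>(x, u). f x u)"
    and "\<And>x u. x \<in> X \<Longrightarrow> f x u \<in> X"
    and "f xbar 0 = xbar"
    and "ISS_Lyapunov X xbar \<omega> f V"
  shows "ISS X \<omega> f"
proof -
  define W where "W x = V x - V xbar" for x
  obtain \<alpha> chi where \<alpha>: "continuous_on {0..} \<alpha>" "\<alpha> 0 = 0" "\<And>r. 0 < r \<Longrightarrow> 0 < \<alpha> r"
    and chi: "class_K chi"
    and decr: "\<And>x u. x \<in> X \<Longrightarrow> chi (norm u) \<le> \<omega> x \<Longrightarrow> V (f x u) - V x \<le> - \<alpha> (W x)"
    using assms(7) unfolding ISS_Lyapunov_def class_K_inf_def W_def by auto
  have sizeW: "size_function X xbar W"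
    using assms(7) unfolding ISS_Lyapunov_def W_def by simp
  note W_nonneg = size_function_nonneg[OF sizeW]
  have W0: "W xbar = 0" and contW: "continuous_on X W"
    using sizeW by (auto simp: size_function_def)
  have \<omega>0: "\<omega> xbar = 0" and cont\<omega>: "continuous_on X \<omega>"
    using assms(3) by (auto simp: size_function_def)
  note \<omega>_nonneg = size_function_nonneg[OF assms(3)]

  obtain \<kappa> where \<kappa>: "class_K \<kappa>" "\<And>x. x \<in> X \<Longrightarrow> \<omega> x \<le> \<kappa> (W x)"
    using size_function_dominates[OF sizeW assms(2) cont\<omega> \<omega>0] by blast
  obtain \<mu> where \<mu>: "class_K \<mu>" "\<And>x. x \<in> X \<Longrightarrow> W x \<le> \<mu> (\<omega> x)"
    using size_function_dominates[OF assms(3,2) contW W0] by blast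
  have contWf: "continuous_on (X \<times> UNIV) (\<lambda>z. W (case z of (x, u) \<Rightarrow> f x u))"
    by (rule continuous_on_compose2[OF contW assms(4)]) (use assms(5) in auto)
  \<comment> \<open>The equilibrium condition \<open>f xbar 0 = xbar\<close> makes the dominated
    function vanish at \<open>(xbar, 0)\<close>, as domination requires.\<close>
  obtain \<nu> where \<nu>_K: "class_K \<nu>"
    and \<nu>: "\<And>z. z \<in> X \<times> UNIV \<Longrightarrow>
      W (case z of (x, u) \<Rightarrow> f x u) \<le> \<nu> (case z of (x, u) \<Rightarrow> max (\<omega> x) (norm u))"
    by (rule size_function_dominates[OF size_function_prod_norm[OF assms(3)] _ contWf])
       (use assms(2,6) W0 in auto)

  \<comment> \<open>When \<open>\<omega> x \<le> chi c\<close> and \<open>norm u \<le> c\<close>,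
    the first summand bounds \<open>W x\<close> and the second bounds \<open>W (f x u)\<close>,
    since \<open>chi c + c\<close> exceeds both \<open>\<omega> x\<close> and \<open>norm u\<close>.
    The sum bounds both at once.\<close>
  define b where "b c = \<mu> (chi c) + \<nu> (chi c + c)" for c
  have b: "class_K b"
    unfolding b_def
    by (intro class_K_add class_K_compose[OF \<mu>(1)] class_K_compose[OF \<nu>_K] chi class_K_id)
  define g where "g = running_max (\<lambda>s. s - \<alpha> s)"
  interpret contractive_gain g
    unfolding g_def using \<alpha> by (rule contractive_gain_running_max)
  have g_upper: "s - \<alpha> s \<le> g s" if "0 \<le> s" for s
    unfolding g_def using that \<alpha>(1)
    by (intro running_max_upper[where h = "\<lambda>s. s - \<alpha> s"]) (auto intro!: continuous_intros)

  \<comment> \<open>If \<open>\<omega> x \<le> chi c\<close>, both \<open>W x\<close> and its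
    successor are at most \<open>b c\<close>. Otherwise dissipation gives
    \<open>W (f x u) \<le> g (W x)\<close>, and \<open>g (W x) \<le> W x\<close> keeps the successor
    below \<open>b c\<close> whenever \<open>W x\<close> is.\<close>
  have step: "W (f x u) \<le> (if W x \<le> b c then b c else g (W x))"
    if "x \<in> X" "norm u \<le> c" for x u c
  proof (cases "\<omega> x \<le> chi c")
    case True
    have "0 \<le> c" using that norm_ge_zero[of u] by linarith
    note chi_nonneg = class_K_nonneg[OF chi this]
    have "\<nu> (max (\<omega> x) (norm u)) \<le> \<nu> (chi c + c)"
      using that True \<open>0 \<le> c\<close> chi_nonneg \<omega>_nonneg[OF that(1)]
      by (intro class_K_mono[OF \<nu>_K]) auto
    then have "W (f x u) \<le> b c"
      using \<nu>[of "(x, u)"] that(1) class_K_nonneg[OF \<mu>(1) chi_nonneg] by (simp add: b_def)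
    moreover have "W x \<le> b c"
      using \<mu>(2)[OF that(1)] class_K_mono[OF \<mu>(1) \<omega>_nonneg[OF that(1)] True]
        class_K_nonneg[OF \<nu>_K, of "chi c + c"] \<open>0 \<le> c\<close> chi_nonneg by (simp add: b_def)
    ultimately show ?thesis by simp
  next
    case False
    then have "W (f x u) \<le> g (W x)"
      using decr[OF that(1), of u] class_K_mono[OF chi _ that(2)] g_upper[OF W_nonneg[OF that(1)]]
      by (simp add: W_def)
    with le[OF W_nonneg[OF that(1)]] show ?thesis by auto
  qed

  show ?thesis
    unfolding ISS_def
  proof (intro exI conjI allI impI ballI)
    show "class_KL (\<lambda>r t. \<kappa> ((g ^^ nat \<lfloor>t\<rfloor>) (\<mu> r)) + r * (1 / (1 + t)))"
      using \<kappa>(1) \<mu>(1) by (rule class_KL_funpow)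
    show "class_K_inf (\<lambda>c. \<kappa> (b c) + c)"
      by (rule class_K_inf_add_id[OF class_K_compose[OF \<kappa>(1) b]])
    fix u :: "nat \<Rightarrow> real ^ 'm" and x0 t
    assume bdd: "bounded (range u)" and x0: "x0 \<in> X"
    define c where "c = (SUP s. norm (u s))"
    have uc: "norm (u s) \<le> c" for s
      unfolding c_def using bdd
      by (intro cSUP_upper) (auto simp: bounded_iff bdd_above_def)
    then have "0 \<le> c" by (rule order.trans[OF norm_ge_zero])
    define x where "x = trajectory f x0 u"
    have xX: "x n \<in> X" for n
      unfolding x_def by (induction n) (auto intro: x0 assms(5))
    \<comment> \<open>Below \<open>b c\<close> the trajectory stays there. Above it, the induction
      hypothesis must hold through the iterate of \<open>g\<close>, and monotonicity of
      \<open>g\<close> advances that iterate by one.\<close>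
    have W_bound: "W (x n) \<le> max ((g ^^ n) (\<mu> (\<omega> x0))) (b c)" for n
    proof (induction n)
      case 0
      then show ?case using \<mu>(2)[OF x0] by (simp add: x_def le_max_iff_disj)
    next
      case (Suc n)
      have "x (Suc n) = f (x n) (u n)" by (simp add: x_def)
      then have W_Suc: "W (x (Suc n)) \<le> (if W (x n) \<le> b c then b c else g (W (x n)))"
        using step[OF xX uc] by simp
      show ?case
      proof (cases "W (x n) \<le> b c")
        case False
        then have "g (W (x n)) \<le> g ((g ^^ n) (\<mu> (\<omega> x0)))"
          using Suc W_nonneg[OF xX, of n] by (intro mono_onD[OF mono]) auto
        with W_Suc False show ?thesis by (simp add: le_max_iff_disj)
      qed (use W_Suc in simp)
    qed
    define p where "p = (g ^^ t) (\<mu> (\<omega> x0))"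
    have p: "0 \<le> p"
      unfolding p_def using \<omega>_nonneg[OF x0] by (intro funpow_nonneg class_K_nonneg[OF \<mu>(1)])
    have "\<omega> (x t) \<le> \<kappa> (max p (b c))"
      unfolding p_def
      by (rule order.trans[OF \<kappa>(2)[OF xX] class_K_mono[OF \<kappa>(1) W_nonneg[OF xX] W_bound]])
    \<comment> \<open>The maximum is one of its two arguments and \<open>\<kappa>\<close> is
      nonnegative on both, so the sum of the two values is large enough.\<close>
    also have "\<dots> \<le> \<kappa> p + \<kappa> (b c)"
      using p class_K_nonneg[OF b \<open>0 \<le> c\<close>] class_K_nonneg[OF \<kappa>(1)] by (simp add: max_def)
    also have "\<dots> \<le> \<kappa> p + \<omega> x0 * (1 / (1 + real t)) + (\<kappa> (b c) + c)"
      using \<omega>_nonneg[OF x0] \<open>0 \<le> c\<close> by simp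
    finally show "\<omega> (trajectory f x0 u t) \<le>
        \<kappa> ((g ^^ nat \<lfloor>real t\<rfloor>) (\<mu> (\<omega> x0))) + \<omega> x0 * (1 / (1 + real t)) +
        (\<kappa> (b (SUP s. norm (u s))) + (SUP s. norm (u s)))"
      by (simp add: p_def x_def c_def)
  qed
qed

end
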